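(* Let $\mathcal{A}$ be a real tensor of order $m$ and dimension $n\ge 2$ that is an almost strictly semi-positive tensor (almost $\mathbf{E}$-tensor). Then every row-subtensor $R_i(\mathcal{A})$, $i\in I_n$, of $\mathcal{A}$ contains at least one negative entry.
   Context: A real tensor of order $m$ ($m\ge 2$) and dimension $n$ is an array $\mathcal{A}=(a_{i_1\ldots i_m})$ with $a_{i_1\ldots i_m}\in\mathbb{R}$, $i_1,\ldots,i_m\in I_n=\{1,\ldots,n\}$. The $i$th row-subtensor $R_i(\mathcal{A})$ is the tensor of order $m-1$ and dimension $n$ with entries $(R_i(\mathcal{A}))_{i_2\ldots i_m}=a_{ii_2\ldots i_m}$. For $\mathbf{x}\in\mathbb{R}^n$, $\mathcal{A}\mathbf{x}^{m-1}\in\mathbb{R}^n$ is defined by $(\mathcal{A}\mathbf{x}^{m-1})_i=\sum_{i_2,\ldots,i_m=1}^n a_{i i_2\ldots i_m}x_{i_2}\cdots x_{i_m}$. Vector inequalities are componentwise. For nonempty $J\subseteq I_n$, the principal subtensor of $\mathcal{A}$ indexed by $J$ is the tensor of order $m$ and dimension $|J|$ with entries $a_{i_1\ldots i_m}$, $i_1,\ldots,i_m\in J$; it is proper if $J\neq I_n$. $\mathcal{A}$ is strictly semi-positive ($\mathbf{E}$-tensor) if for each $\mathbf{x}\ge\mathbf{0}$, $\mathbf{x}\ne\mathbf{0}$, there is $k\in I_n$ with $x_k>0$ and $(\mathcal{A}\mathbf{x}^{m-1})_k>0$. $\mathcal{A}$ is almost strictly semi-positive (almost $\mathbf{E}$-tensor)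 if every proper principal subtensor of $\mathcal{A}$ is strictly semi-positive and there is $\mathbf{x}>\mathbf{0}$ with $\mathcal{A}\mathbf{x}^{m-1}\le\mathbf{0}$. *)

theory Defs
  imports Complex_Main "HOL-Library.FuncSet"
begin

text \<open>
  A tensor of order \<open>m\<close> over a finite index set \<open>I\<close> is a real-valued function on the multi-indices
  \<open>[i\<^sub>1, \<dots>, i\<^sub>m]\<close> with all \<open>i\<^sub>k\<close> in \<open>I\<close>. Its dimension is \<open>card I\<close>, and a tensor of dimension \<open>n\<close>
  in the usual sense is the case \<open>I = {1..n}\<close>. Allowing an arbitrary \<open>I\<close> lets a principal subtensor keep
  its row and column labels, so that it is a plain restriction of the array. A vector is a function of
  which only the values on \<open>I\<close> matter.
\<close>

definition multi_indices :: "nat \<Rightarrow> nat set \<Rightarrow> nat list set" where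
  "multi_indices m I = {js. length js = m \<and> set js \<subseteq> I}"

definition tensors :: "nat \<Rightarrow> nat set \<Rightarrow> (nat list \<Rightarrow> real) set" where
  "tensors m I = multi_indices m I \<rightarrow>\<^sub>E UNIV"

definition row_subtensor :: "nat \<Rightarrow> nat set \<Rightarrow> (nat list \<Rightarrow> real) \<Rightarrow> nat \<Rightarrow> (nat list \<Rightarrow> real)" where
  "row_subtensor m I A i = (\<lambda>js \<in> multi_indices (m - 1) I. A (i # js))"

definition principal_subtensor :: "nat \<Rightarrow> nat set \<Rightarrow> (nat list \<Rightarrow> real) \<Rightarrow> (nat list \<Rightarrow> real)" where
  "principal_subtensor m J A = restrict A (multi_indices m J)"

text \<open>The \<open>i\<close>-th component of \<open>A x\<^sup>m\<^sup>-\<^sup>1\<close>.\<close>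

definition tensor_apply :: "nat \<Rightarrow> nat set \<Rightarrow> (nat list \<Rightarrow> real) \<Rightarrow> (nat \<Rightarrow> real) \<Rightarrow> nat \<Rightarrow> real" where
  "tensor_apply m I A x i = (\<Sum>js \<in> multi_indices (m - 1) I. A (i # js) * prod_list (map x js))"

definition strictly_semi_positive :: "nat \<Rightarrow> nat set \<Rightarrow> (nat list \<Rightarrow> real) \<Rightarrow> bool" where
  "strictly_semi_positive m I A \<longleftrightarrow>
     (\<forall>x. (\<forall>i\<in>I. x i \<ge> 0) \<and> (\<exists>i\<in>I. x i \<noteq> 0) \<longrightarrow>
        (\<exists>k\<in>I. x k > 0 \<and> tensor_apply m I A x k > 0))"

definition almost_strictly_semi_positive :: "nat \<Rightarrow> nat set \<Rightarrow> (nat list \<Rightarrow> real) \<Rightarrow> bool" where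
  "almost_strictly_semi_positive m I A \<longleftrightarrow>
     (\<forall>J. J \<noteq> {} \<and> J \<subset> I \<longrightarrow> strictly_semi_positive m J (principal_subtensor m J A)) \<and>
     (\<exists>x. (\<forall>i\<in>I. x i > 0) \<and> (\<forall>i\<in>I. tensor_apply m I A x i \<le> 0))"

end

theory Submission
  imports Defs
begin

text \<open>
  The principal subtensor on a single index \<open>i\<close> has only the diagonal entry \<open>a\<^sub>i\<^sub>\<dots>\<^sub>i\<close>, and it is strictly
  semi-positive exactly when this entry is positive. Since the dimension is at least two, \<open>{i}\<close> is a
  proper index set, so an almost strictly semi-positive tensor has a positive diagonal. If the row
  \<open>i\<close> had no negative entry, then for every positive vector \<open>x\<close> the \<open>i\<close>-th component of
  \<open>A x\<^sup>m\<^sup>-\<^sup>1\<close> would be a sum of nonnegative terms, among them the positive diagonal term; it would be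
  positive, whereas some positive \<open>x\<close> makes all components nonpositive.
\<close>

lemma finite_multi_indices:
  assumes "finite I"
  shows "finite (multi_indices m I)"
  using finite_lists_length_eq[OF assms, of m]
  by (simp add: multi_indices_def conj_commute)

lemma multi_indices_singleton: "multi_indices m {i} = {replicate m i}"
  by (auto simp: multi_indices_def subset_singleton_iff intro!: replicate_eqI)

lemma prod_list_map_pos:
  fixes x :: "'a \<Rightarrow> 'b :: linordered_semidom"
  assumes "\<And>j. j \<in> set js \<Longrightarrow> x j > 0"
  shows "prod_list (map x js) > 0"
  using assms by (induction js) simp_all

lemma diagonal_pos_if_singleton_strictly_semi_positive:
  assumes "m \<ge> 1"
    and "strictly_semi_positive m {i} (principal_subtensor m {i} A)"
  shows "A (replicate m i) > 0"
proof -
  from \<open>m \<ge> 1\<close> obtain k where m: "m = Suc k"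
    by (cases m) simp_all
  \<comment> \<open>For the vector with all components 1, the component at \<open>i\<close> is the diagonal entry itself.\<close>
  have "tensor_apply m {i} (principal_subtensor m {i} A) (\<lambda>_. 1) i > 0"
    using assms(2)[unfolded strictly_semi_positive_def, rule_format, of "\<lambda>_. 1"] by simp
  then show ?thesis
    by (simp add: tensor_apply_def principal_subtensor_def multi_indices_singleton m
        map_replicate_const)
qed

lemma tensor_apply_pos:
  assumes "finite I" and "i \<in> I" and "m \<ge> 1"
    and x: "\<And>j. j \<in> I \<Longrightarrow> x j > 0"
    and nonneg: "\<And>js. js \<in> multi_indices (m - 1) I \<Longrightarrow> A (i # js) \<ge> 0"
    and diag: "A (replicate m i) > 0"
  shows "tensor_apply m I A x i > 0"
  unfolding tensor_apply_def
proof (rule sum_pos2)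
  show "finite (multi_indices (m - 1) I)"
    using \<open>finite I\<close> by (rule finite_multi_indices)
  show mem: "replicate (m - 1) i \<in> multi_indices (m - 1) I"
    using \<open>i \<in> I\<close> by (auto simp: multi_indices_def)
  have prod_pos: "prod_list (map x js) > 0" if "js \<in> multi_indices (m - 1) I" for js
    using that x by (intro prod_list_map_pos) (auto simp: multi_indices_def)
  from \<open>m \<ge> 1\<close> have "i # replicate (m - 1) i = replicate m i"
    by (cases m) simp_all
  with diag prod_pos[OF mem]
  show "0 < A (i # replicate (m - 1) i) * prod_list (map x (replicate (m - 1) i))"
    by (metis mult_pos_pos)
  show "0 \<le> A (i # js) * prod_list (map x js)" if "js \<in> multi_indices (m - 1) I" for js
    using nonneg[OF that] prod_pos[OF that] by simp
qed

theorem theorem6: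
  fixes m n :: nat and A :: "nat list \<Rightarrow> real"
  assumes "m \<ge> 2" and "n \<ge> 2"
    and "A \<in> tensors m {1..n}"
    and "almost_strictly_semi_positive m {1..n} A"
  shows "\<forall>i\<in>{1..n}. \<exists>js \<in> multi_indices (m - 1) {1..n}. row_subtensor m {1..n} A i js < 0"
proof (intro ballI, rule ccontr)
  fix i
  assume i: "i \<in> {1..n}"
    and "\<not> (\<exists>js \<in> multi_indices (m - 1) {1..n}. row_subtensor m {1..n} A i js < 0)"
  then have nonneg: "A (i # js) \<ge> 0" if "js \<in> multi_indices (m - 1) {1..n}" for js
    using that by (force simp: row_subtensor_def)
  obtain x where x: "\<And>j. j \<in> {1..n} \<Longrightarrow> x j > 0"
    and Ax: "tensor_apply m {1..n} A x i \<le> 0"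
    using assms(4) i unfolding almost_strictly_semi_positive_def by blast
  have "{i} \<noteq> {1..n}"
    using \<open>n \<ge> 2\<close> by (auto dest: arg_cong[of _ _ card])
  with i have "{i} \<subset> {1..n}"
    by blast
  with assms(4) have "strictly_semi_positive m {i} (principal_subtensor m {i} A)"
    unfolding almost_strictly_semi_positive_def by blast
  with \<open>m \<ge> 2\<close> have "A (replicate m i) > 0"
    by (intro diagonal_pos_if_singleton_strictly_semi_positive) simp_all
  with i x nonneg \<open>m \<ge> 2\<close> have "tensor_apply m {1..n} A x i > 0"
    by (intro tensor_apply_pos) simp_all
  with Ax show False
    by simp
qed

end
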